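(* Let $\mathfrak F$ be a stable filtration functor with Lipschitz constant $L(\mathfrak F)$. For all metric measure spaces $X,Y$, integers $n\ge 1$, $k\ge 0$, and $p\ge 1$, $$d^{\mathcal D}_{\mathcal W,p}\big(U^{\mathfrak F}_{n,k}(X),U^{\mathfrak F}_{n,k}(Y)\big)\le\frac{L(\mathfrak F)}{2}\cdot d_{\mathcal W,p}(\mu_n(X),\mu_n(Y))$$ and, as a consequence, $$d^{\mathcal D}_{\mathcal W,p}\big(U^{\mathfrak F}_{n,k}(X),U^{\mathfrak F}_{n,k}(Y)\big)\le L(\mathfrak F)\cdot\widehat d_{\mathcal{GW},p}(X,Y).$$
   Context: A metric measure space (mm-space) is $(X,d_X,\mu_X)$ with $(X,d_X)$ compact metric and $\mu_X$ a fully supported Borel probability measure. Filtration functors. A filtered set is a pair $(X,F_X)$ with $X$ a finite set and $F_X:\mathrm{pow}(X)\to\mathbb R$ on nonempty subsets with $F_X(\sigma)\le F_X(\tau)$ if $\sigma\subset\tau$; morphisms $(X,F_X)\to(Y,F_Y)$ are maps $\varphi:X\to Y$ with $F_Y(\varphi(\sigma))\le F_X(\sigma)$. A filtration functor $\mathfrak F$ is a functor from finite metric spaces with 1-Lipschitz maps to filtered sets, of the form $X\mapsto (X,F_X^{\mathfrak F})$. For $r\ge0$ let $L_r=\{\sigma\subset X: F_X^{\mathfrak F}(\sigma)\le r\}$; the persistence module $r\mapsto\widetilde H_k(L_r;\mathbb F)$ (reduced homology over a fixed field) decomposes into finitely many intervals $[b_\alpha,d_\alpha)$, and $\mathrm{dgm}_k^{\mathfrak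 F}(X)$ is the multiset of points $(b_\alpha,d_\alpha)$. $\mathcal D$ is the set of all finite persistence diagrams with the bottleneck distance $d_{\mathcal B}$ ($\ell^\infty$ cost for matched points, half the persistence for unmatched points). $\mathfrak F$ is stable if there is $L>0$ with $d_{\mathcal B}(\mathrm{dgm}_k^{\mathfrak F}(X),\mathrm{dgm}_k^{\mathfrak F}(Y))\le L\cdot d_{\mathcal{GH}}(X,Y)$ for all finite metric spaces $X,Y$ and all $k\ge 0$ ($d_{\mathcal{GH}}=\frac12\inf_R\mathrm{dis}(R)$ the Gromov-Hausdorff distance); the infimal such $L$ is $L(\mathfrak F)$. For the distance matrix $M$ of a finite tuple of points, $\mathrm{dgm}^{\mathfrak F}_k(M)$ is the diagram of the underlying metric space (points at distance $0$ identified). Measures. $\Psi^{(n)}_X:X^n\to\mathbb R^{n\times n}$ sends $(x_1,\dots,x_n)$ to $(d_X(x_i,x_j))_{i,j}$; $\mu_n(X):=(\Psi_X^{(n)})_\#\mu_X^{\otimes n}$ is the $n$-th curvature measure; $U^{\mathfrak F}_{n,k}(X):=(\mathrm{dgm}_k^{\mathfrak F})_\#\mu_n(X)$ is the persistence measure, a probability measure on $\mathcal D$. $d_{\mathcal W,p}$ is the $p$-Wasserstein distance for $\mathbb R^{n\times n}$ with the $\ell^\infty$ metric, $d^{\mathcal D}_{\mathcal W,p}$ that for $(\mathcal D,d_{\mathcal B})$, and $\widehat d_{\mathcal{GW},p}(X,Y):=\frac12\sup_{n\in\mathbb N}d_{\mathcal W,p}(\mu_n(X),\mu_n(Y))$.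 *)

theory Defs
  imports "HOL-Probability.Probability" "HOL-Library.Multiset" "HOL-Library.Function_Algebras"
begin

section \<open>Persistence diagrams and the bottleneck distance\<close>

definition linf_point :: "real \<times> real \<Rightarrow> real \<times> real \<Rightarrow> real" where
  "linf_point x y = max \<bar>fst x - fst y\<bar> \<bar>snd x - snd y\<bar>"

definition half_pers :: "real \<times> real \<Rightarrow> real" where
  "half_pers x = (snd x - fst x) / 2"

text \<open>A partial matching of two multisets \<open>D\<close> and \<open>E\<close> is a multiset of pairs whose first components
  form a submultiset of \<open>D\<close> and whose second components form a submultiset of \<open>E\<close>.\<close>

definition partial_matching ::
  "(real \<times> real) multiset \<Rightarrow> (real \<times> real) multiset \<Rightarrow> ((real \<times> real) \<times> (real \<times> real)) multiset \<Rightarrow> bool"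
where
  "partial_matching D E M \<longleftrightarrow> image_mset fst M \<subseteq># D \<and> image_mset snd M \<subseteq># E"

definition matching_cost ::
  "(real \<times> real) multiset \<Rightarrow> (real \<times> real) multiset \<Rightarrow> ((real \<times> real) \<times> (real \<times> real)) multiset \<Rightarrow> real"
where
  "matching_cost D E M = Max (insert 0
      ((\<lambda>(x, y). linf_point x y) ` set_mset M
       \<union> half_pers ` set_mset (D - image_mset fst M)
       \<union> half_pers ` set_mset (E - image_mset snd M)))"

definition bottleneck :: "(real \<times> real) multiset \<Rightarrow> (real \<times> real) multiset \<Rightarrow> real" where
  "bottleneck D E = Inf {matching_cost D E M | M. partial_matching D E M}"

lemma matching_cost_le_iff:
  "matching_cost D E M \<le> c \<longleftrightarrow> 0 \<le> c \<and> (\<forall>x y. (x, y) \<in># M \<longrightarrow> linf_point x y \<le> c)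
     \<and> (\<forall>x. x \<in># D - image_mset fst M \<longrightarrow> half_pers x \<le> c)
     \<and> (\<forall>y. y \<in># E - image_mset snd M \<longrightarrow> half_pers y \<le> c)"
  unfolding matching_cost_def by (subst Max_le_iff) (auto split: prod.splits)

lemma bottleneck_attained:
  obtains M where "partial_matching D E M" "bottleneck D E = matching_cost D E M"
proof -
  let ?S = "{matching_cost D E M | M. partial_matching D E M}"
  let ?V = "insert 0 ((\<lambda>(x, y). linf_point x y) ` (set_mset D \<times> set_mset E)
      \<union> half_pers ` set_mset D \<union> half_pers ` set_mset E)"
  have "matching_cost D E M \<in> ?V" if M: "partial_matching D E M" for M
  proof -
    have "set_mset (image_mset fst M) \<subseteq> set_mset D" "set_mset (image_mset snd M) \<subseteq> set_mset E"
      using M unfolding partial_matching_def by (meson set_mset_mono)+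
    then have "set_mset M \<subseteq> set_mset D \<times> set_mset E"
      by force
    moreover have "matching_cost D E M \<in> insert 0 ((\<lambda>(x, y). linf_point x y) ` set_mset M
       \<union> half_pers ` set_mset (D - image_mset fst M)
       \<union> half_pers ` set_mset (E - image_mset snd M))"
      unfolding matching_cost_def by (rule Max_in) auto
    moreover have "set_mset (D - image_mset fst M) \<subseteq> set_mset D"
      "set_mset (E - image_mset snd M) \<subseteq> set_mset E"
      by (auto dest: in_diffD)
    ultimately show ?thesis
      by (blast intro: imageI)
  qed
  then have "?S \<subseteq> ?V" by blast
  then have fin: "finite ?S" by (rule finite_subset) auto
  have "matching_cost D E {#} \<in> ?S"
    by (auto simp: partial_matching_def)
  then have ne: "?S \<noteq> {}" by blast
  have "Inf ?S = Min ?S" using fin ne by (rule cInf_eq_Min)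
  then have "bottleneck D E \<in> ?S"
    unfolding bottleneck_def using Min_in[OF fin ne] by simp
  then show ?thesis using that by blast
qed

lemma matching_cost_nonneg: "0 \<le> matching_cost D E M"
  unfolding matching_cost_def by (rule Max_ge) auto

lemma bottleneck_le: "partial_matching D E M \<Longrightarrow> bottleneck D E \<le> matching_cost D E M"
  unfolding bottleneck_def
  by (rule cInf_lower) (auto intro!: bdd_belowI[of _ 0] matching_cost_nonneg)

lemma bottleneck_nonneg: "0 \<le> bottleneck D E"
  by (metis bottleneck_attained matching_cost_nonneg)

lemma linf_point_commute: "linf_point x y = linf_point y x"
  by (simp add: linf_point_def abs_minus_commute)

lemma linf_point_eq_0: "linf_point x y \<le> 0 \<Longrightarrow> x = y"
  by (auto simp: linf_point_def prod_eq_iff)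

lemma linf_point_triangle: "linf_point x z \<le> linf_point x y + linf_point y z"
  by (auto simp: linf_point_def max_def)

lemma half_pers_le: "half_pers x \<le> half_pers y + linf_point x y"
  by (auto simp: half_pers_def linf_point_def max_def field_simps abs_if split: if_splits)

lemma bottleneck_commute_le: "bottleneck E D \<le> bottleneck D E"
proof -
  obtain M where M: "partial_matching D E M" "bottleneck D E = matching_cost D E M"
    by (rule bottleneck_attained)
  let ?N = "image_mset prod.swap M"
  have eq: "image_mset fst ?N = image_mset snd M" "image_mset snd ?N = image_mset fst M"
    by (simp_all add: image_mset.compositionality comp_def)
  have M': "\<And>x y. (x, y) \<in># M \<Longrightarrow> linf_point x y \<le> matching_cost D E M"
    "\<And>x. x \<in># D - image_mset fst M \<Longrightarrow> half_pers x \<le> matching_cost D E M"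
    "\<And>y. y \<in># E - image_mset snd M \<Longrightarrow> half_pers y \<le> matching_cost D E M"
    using matching_cost_le_iff[of D E M "matching_cost D E M"] by auto
  have "matching_cost E D ?N \<le> matching_cost D E M"
    unfolding matching_cost_le_iff[of E D] eq
  proof (intro conjI allI impI)
    fix x y assume "(x, y) \<in># ?N"
    then have "(y, x) \<in># M" by auto
    then show "linf_point x y \<le> matching_cost D E M"
      using M'(1)[of y x] linf_point_commute[of x y] by simp
  qed (use M' matching_cost_nonneg in auto)
  moreover have "partial_matching E D ?N"
    using M(1) unfolding partial_matching_def eq by simp
  ultimately show ?thesis using M(2) bottleneck_le by fastforce
qed

lemma bottleneck_refl: "bottleneck D D = 0"
proof -
  let ?M = "image_mset (\<lambda>x. (x, x)) D"
  have "partial_matching D D ?M" "matching_cost D D ?M \<le> 0"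
    unfolding matching_cost_le_iff partial_matching_def
    by (auto simp: image_mset.compositionality comp_def linf_point_def)
  then show ?thesis
    using bottleneck_le bottleneck_nonneg by (meson order_antisym order_trans)
qed

lemma multiset_join:
  "image_mset snd A = image_mset fst B \<Longrightarrow>
   \<exists>T. A = image_mset (\<lambda>(x, y, z). (x, y)) T \<and> B = image_mset (\<lambda>(x, y, z). (y, z)) T"
proof (induction A arbitrary: B)
  case empty
  then show ?case by (intro exI[of _ "{#}"]) auto
next
  case (add a A)
  obtain x y where a: "a = (x, y)" by (cases a)
  have "y \<in># image_mset fst B" unfolding add.prems[symmetric] a by simp
  then obtain z where z: "(y, z) \<in># B" by auto
  then obtain B' where B: "B = add_mset (y, z) B'" by (metis multi_member_split)
  have "image_mset snd A = image_mset fst B'" using add.prems by (simp add: a B)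
  then obtain T where T: "A = image_mset (\<lambda>(x, y, z). (x, y)) T" "B' = image_mset (\<lambda>(x, y, z). (y, z)) T"
    using add.IH by blast
  show ?case
    by (intro exI[of _ "add_mset (x, y, z) T"]) (simp only: image_mset_add_mset prod.case T[symmetric] a B simp_thms)
qed

lemma bottleneck_triangle: "bottleneck D G \<le> bottleneck D E + bottleneck E G"
proof -
  obtain M where M: "partial_matching D E M" and bM: "bottleneck D E = matching_cost D E M"
    by (rule bottleneck_attained)
  obtain N where N: "partial_matching E G N" and bN: "bottleneck E G = matching_cost E G N"
    by (rule bottleneck_attained)
  define c where "c = matching_cost D E M"
  define e where "e = matching_cost E G N"
  have c: "0 \<le> c" "\<And>x y. (x, y) \<in># M \<Longrightarrow> linf_point x y \<le> c"
    "\<And>x. x \<in># D - image_mset fst M \<Longrightarrow> half_pers x \<le> c"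
    "\<And>y. y \<in># E - image_mset snd M \<Longrightarrow> half_pers y \<le> c"
    using matching_cost_le_iff[of D E M c] unfolding c_def by auto
  have e: "0 \<le> e" "\<And>x y. (x, y) \<in># N \<Longrightarrow> linf_point x y \<le> e"
    "\<And>x. x \<in># E - image_mset fst N \<Longrightarrow> half_pers x \<le> e"
    "\<And>y. y \<in># G - image_mset snd N \<Longrightarrow> half_pers y \<le> e"
    using matching_cost_le_iff[of E G N e] unfolding e_def by auto
  define C where "C = image_mset snd M \<inter># image_mset fst N"
  have "image_mset snd M = C + (image_mset snd M - C)" "image_mset fst N = C + (image_mset fst N - C)"
    by (auto simp: C_def multiset_eq_iff)
  then obtain A B A' B' where
    A: "M = A + B" "image_mset snd A = C" "image_mset snd B = image_mset snd M - C" and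
    A': "N = A' + B'" "image_mset fst A' = C" "image_mset fst B' = image_mset fst N - C"
    by (metis image_mset_eq_plusD)
  obtain T where T: "A = image_mset (\<lambda>(x, y, z). (x, y)) T" "A' = image_mset (\<lambda>(x, y, z). (y, z)) T"
    using multiset_join[of A A'] A(2) A'(2) by auto
  define P where "P = image_mset (\<lambda>(x, y, z). (x, z)) T"
  have P: "image_mset fst P = image_mset fst A" "image_mset snd P = image_mset snd A'"
    by (simp_all add: P_def T image_mset.compositionality comp_def case_prod_beta)
  have pm: "partial_matching D G P"
    using M N unfolding partial_matching_def P A(1) A'(1)
    by (auto intro: subset_mset.order_trans[OF mset_subset_eq_add_left])
  have E1: "image_mset snd M - C = image_mset snd M - image_mset fst N"
    and E2: "image_mset fst N - C = image_mset fst N - image_mset snd M"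
    by (auto simp: C_def multiset_eq_iff)
  have sub1: "image_mset snd B \<subseteq># E - image_mset fst N"
    using M unfolding A(3) E1 partial_matching_def
    by (auto simp: subseteq_mset_def intro: diff_le_mono)
  have sub2: "image_mset fst B' \<subseteq># E - image_mset snd M"
    using N unfolding A'(3) E2 partial_matching_def
    by (auto simp: subseteq_mset_def intro: diff_le_mono)
  have "matching_cost D G P \<le> c + e"
    unfolding matching_cost_le_iff
  proof (intro conjI allI impI)
    show "0 \<le> c + e" using c(1) e(1) by simp
  next
    fix x z assume "(x, z) \<in># P"
    then obtain y where "(x, y, z) \<in># T" by (auto simp: P_def)
    then have "(x, y) \<in># M" "(y, z) \<in># N" unfolding A(1) A'(1) T by force+
    then show "linf_point x z \<le> c + e"
      using c(2) e(2) linf_point_triangle[of x z y] by fastforce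
  next
    fix x assume x: "x \<in># D - image_mset fst P"
    have "x \<in># (D - image_mset fst M) + image_mset fst B"
    proof -
      have "image_mset fst A + image_mset fst B \<subseteq># D"
        using M unfolding partial_matching_def A(1) by simp
      then have "D - image_mset fst A = (D - image_mset fst M) + image_mset fst B"
        unfolding A(1)
        by (auto simp: multiset_eq_iff subseteq_mset_def)
      then show ?thesis using x by (simp add: P)
    qed
    then consider "x \<in># D - image_mset fst M" | y where "(x, y) \<in># B" by auto
    then show "half_pers x \<le> c + e"
    proof cases
      case 1
      then show ?thesis using c(3)[of x] e(1) by simp
    next
      case 2
      then have "y \<in># E - image_mset fst N" "(x, y) \<in># M"
        using mset_subset_eqD[OF sub1, of y] unfolding A(1) by force+
      then show ?thesis using e(3)[of y] c(2)[of x y] half_pers_le[of x y] by simp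
    qed
  next
    fix z assume z: "z \<in># G - image_mset snd P"
    have "z \<in># (G - image_mset snd N) + image_mset snd B'"
    proof -
      have "image_mset snd A' + image_mset snd B' \<subseteq># G"
        using N unfolding partial_matching_def A'(1) by simp
      then have "G - image_mset snd A' = (G - image_mset snd N) + image_mset snd B'"
        unfolding A'(1)
        by (auto simp: multiset_eq_iff subseteq_mset_def)
      then show ?thesis using z by (simp add: P)
    qed
    then consider "z \<in># G - image_mset snd N" | y where "(y, z) \<in># B'" by auto
    then show "half_pers z \<le> c + e"
    proof cases
      case 1
      then show ?thesis using e(4)[of z] c(1) by simp
    next
      case 2
      then have "y \<in># E - image_mset snd M" "(y, z) \<in># N"
        using mset_subset_eqD[OF sub2, of y] unfolding A'(1) by force+
      then show ?thesis
        using c(4)[of y] e(2)[of y z] half_pers_le[of z y] by (simp add: linf_point_commute)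
    qed
  qed
  then show ?thesis using bottleneck_le[OF pm] bM bN by (simp add: c_def e_def)
qed

lemma bottleneck_eq_0:
  assumes "bottleneck D E = 0" "\<forall>x\<in>#D + E. half_pers x > 0"
  shows "D = E"
proof -
  obtain M where M: "partial_matching D E M" "bottleneck D E = matching_cost D E M"
    by (rule bottleneck_attained)
  have "matching_cost D E M \<le> 0" using M assms by simp
  then have *: "\<forall>x y. (x, y) \<in># M \<longrightarrow> linf_point x y \<le> 0"
    "\<forall>x. x \<in># D - image_mset fst M \<longrightarrow> half_pers x \<le> 0"
    "\<forall>x. x \<in># E - image_mset snd M \<longrightarrow> half_pers x \<le> 0"
    unfolding matching_cost_le_iff by blast+
  have "D - image_mset fst M = {#}" "E - image_mset snd M = {#}"
    using *(2,3) assms(2) by (meson in_diffD multiset_nonemptyE not_le union_iff)+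
  then have "D = image_mset fst M" "E = image_mset snd M"
    using M(1) unfolding partial_matching_def
    by (metis subset_mset.diff_add add_0)+
  moreover have "image_mset fst M = image_mset snd M"
    using *(1) linf_point_eq_0 by (intro image_mset_cong) (metis prod.collapse)
  ultimately show ?thesis by simp
qed

text \<open>The metric space of finite persistence diagrams.\<close>

typedef pdiagram = "{D :: (real \<times> real) multiset. \<forall>(b, d)\<in>#D. 0 \<le> b \<and> b < d}"
  by (rule exI[of _ "{#}"]) simp

instantiation pdiagram :: metric_space
begin

definition dist_pdiagram :: "pdiagram \<Rightarrow> pdiagram \<Rightarrow> real" where
  "dist_pdiagram D E = bottleneck (Rep_pdiagram D) (Rep_pdiagram E)"

definition uniformity_pdiagram :: "(pdiagram \<times> pdiagram) filter" where
  "uniformity_pdiagram = (INF e\<in>{0 <..}. principal {(x, y). dist x y < e})"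

definition open_pdiagram :: "pdiagram set \<Rightarrow> bool" where
  "open_pdiagram U \<longleftrightarrow> (\<forall>x\<in>U. eventually (\<lambda>(x', y). x' = x \<longrightarrow> y \<in> U) uniformity)"

instance
proof
  fix D E G :: pdiagram
  show "dist D E = 0 \<longleftrightarrow> D = E"
  proof
    assume "dist D E = 0"
    moreover have "\<forall>x\<in>#Rep_pdiagram D + Rep_pdiagram E. half_pers x > 0"
      using Rep_pdiagram[of D] Rep_pdiagram[of E] by (auto simp: half_pers_def)
    ultimately have "Rep_pdiagram D = Rep_pdiagram E"
      by (intro bottleneck_eq_0) (auto simp: dist_pdiagram_def)
    then show "D = E" by (simp add: Rep_pdiagram_inject)
  qed (simp add: dist_pdiagram_def bottleneck_refl)
  show "dist D E \<le> dist D G + dist E G"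
    using bottleneck_triangle[of "Rep_pdiagram D" "Rep_pdiagram E" "Rep_pdiagram G"]
      bottleneck_commute_le[of "Rep_pdiagram G" "Rep_pdiagram E"]
    by (simp add: dist_pdiagram_def)
qed (simp_all add: uniformity_pdiagram_def open_pdiagram_def)

end


section \<open>Persistence modules and interval decompositions\<close>

text \<open>Persistence modules indexed by \<open>{0..}\<close>: a vector space over \<open>'f\<close> (with explicit carrier) for
  every \<open>r \<ge> 0\<close> and a structure map for every pair \<open>0 \<le> r \<le> s\<close>.\<close>

record ('f, 'v) pmodule =
  pm_carrier :: "real \<Rightarrow> 'v set"
  pm_add :: "real \<Rightarrow> 'v \<Rightarrow> 'v \<Rightarrow> 'v"
  pm_scale :: "real \<Rightarrow> 'f \<Rightarrow> 'v \<Rightarrow> 'v"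
  pm_map :: "real \<Rightarrow> real \<Rightarrow> 'v \<Rightarrow> 'v"

definition pmodule_iso ::
  "('f, 'v) pmodule \<Rightarrow> ('f, 'w) pmodule \<Rightarrow> (real \<Rightarrow> 'v \<Rightarrow> 'w) \<Rightarrow> bool"
where
  "pmodule_iso P Q \<phi> \<longleftrightarrow>
     (\<forall>r\<ge>0. bij_betw (\<phi> r) (pm_carrier P r) (pm_carrier Q r)
        \<and> (\<forall>x\<in>pm_carrier P r. \<forall>y\<in>pm_carrier P r.
              \<phi> r (pm_add P r x y) = pm_add Q r (\<phi> r x) (\<phi> r y))
        \<and> (\<forall>a. \<forall>x\<in>pm_carrier P r. \<phi> r (pm_scale P r a x) = pm_scale Q r a (\<phi> r x)))
   \<and> (\<forall>r s. 0 \<le> r \<longrightarrow> r \<le> s \<longrightarrow>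
        (\<forall>x\<in>pm_carrier P r. \<phi> s (pm_map P r s x) = pm_map Q r s (\<phi> r x)))"

text \<open>The direct sum of the interval modules of the intervals \<open>[b, d)\<close> with \<open>(b, d)\<close> in the list
  \<open>ps\<close>.  A vector at \<open>r\<close> has one coordinate for each interval of the list containing \<open>r\<close>; the
  structure map is the identity on the intervals containing both \<open>r\<close> and \<open>s\<close>, and zero on the others.\<close>

definition alive :: "(real \<times> real) list \<Rightarrow> real \<Rightarrow> nat set" where
  "alive ps r = {\<alpha>. \<alpha> < length ps \<and> fst (ps ! \<alpha>) \<le> r \<and> r < snd (ps ! \<alpha>)}"

definition interval_sum :: "(real \<times> real) list \<Rightarrow> ('f::field, nat \<Rightarrow> 'f) pmodule" where
  "interval_sum ps =
    \<lparr> pm_carrier = (\<lambda>r. {x. \<forall>\<alpha>. x \<alpha> \<noteq> 0 \<longrightarrow> \<alpha> \<in> alive ps r}),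
      pm_add = (\<lambda>r x y. x + y),
      pm_scale = (\<lambda>r a x \<alpha>. a * x \<alpha>),
      pm_map = (\<lambda>r s x \<alpha>. if \<alpha> \<in> alive ps s then x \<alpha> else 0) \<rparr>"

section \<open>Simplicial homology over a field\<close>

text \<open>A simplicial complex is a down-closed family of finite nonempty sets of natural numbers.  Every
  simplex is oriented by the order of its vertices in \<open>nat\<close>, so that a \<open>k\<close>-chain is a function on
  simplices supported on those with \<open>k + 1\<close> vertices.  The coefficient of \<open>\<tau>\<close> in the boundary of \<open>c\<close>
  collects the simplices \<open>insert v \<tau>\<close>, in which \<open>v\<close> occupies position \<open>card {u \<in> \<tau>. u < v}\<close>.\<close>

definition chains :: "nat set set \<Rightarrow> nat \<Rightarrow> (nat set \<Rightarrow> 'f::field) set" where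
  "chains K k = {c. \<forall>\<sigma>. c \<sigma> \<noteq> 0 \<longrightarrow> \<sigma> \<in> K \<and> card \<sigma> = k + 1}"

definition boundary :: "(nat set \<Rightarrow> 'f::field) \<Rightarrow> nat set \<Rightarrow> 'f" where
  "boundary c \<tau> = (\<Sum>v | v \<notin> \<tau> \<and> c (insert v \<tau>) \<noteq> 0. (-1) ^ card {u \<in> \<tau>. u < v} * c (insert v \<tau>))"

text \<open>The boundary of a 0-chain takes the value \<open>\<Sum>v. c {v}\<close> at the empty simplex, i.e. it is the
  augmentation.  Hence these are the cycles of the augmented complex, and the quotient below is
  reduced homology in all degrees \<open>k \<ge> 0\<close>.\<close>

definition reduced_cycles :: "nat set set \<Rightarrow> nat \<Rightarrow> (nat set \<Rightarrow> 'f::field) set" where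
  "reduced_cycles K k = {c \<in> chains K k. \<forall>\<tau>. boundary c \<tau> = 0}"

definition boundaries :: "nat set set \<Rightarrow> nat \<Rightarrow> (nat set \<Rightarrow> 'f::field) set" where
  "boundaries K k = boundary ` chains K (k + 1)"

text \<open>The persistence module \<open>r \<mapsto> H\<^sub>k(K r)\<close> (reduced) of an increasing family \<open>K\<close> of complexes.  Its
  vectors are the cosets \<open>z + B\<close> of the space \<open>B\<close> of boundaries; the structure maps are induced by the
  inclusions.\<close>

definition homology_pmodule ::
  "(real \<Rightarrow> nat set set) \<Rightarrow> nat \<Rightarrow> ('f::field, (nat set \<Rightarrow> 'f) set) pmodule"
where
  "homology_pmodule K k =
    \<lparr> pm_carrier = (\<lambda>r. {{z + w | w. w \<in> boundaries (K r) k} | z. z \<in> reduced_cycles (K r) k}),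
      pm_add = (\<lambda>r A A'. {z + z' | z z'. z \<in> A \<and> z' \<in> A'}),
      pm_scale = (\<lambda>r a A. {(\<lambda>\<sigma>. a * z \<sigma>) + w | z w. z \<in> A \<and> w \<in> boundaries (K r) k}),
      pm_map = (\<lambda>r s A. {z + w | z w. z \<in> A \<and> w \<in> boundaries (K s) k}) \<rparr>"

section \<open>Filtration functors\<close>

definition finite_metric :: "'a metric \<Rightarrow> bool" where
  "finite_metric X \<longleftrightarrow> finite (mspace X) \<and> mspace X \<noteq> {}"

definition lipschitz1 :: "'a metric \<Rightarrow> 'b metric \<Rightarrow> ('a \<Rightarrow> 'b) \<Rightarrow> bool" where
  "lipschitz1 X Y \<phi> \<longleftrightarrow> \<phi> ` mspace X \<subseteq> mspace Y
     \<and> (\<forall>x\<in>mspace X. \<forall>x'\<in>mspace X. mdist Y (\<phi> x) (\<phi> x') \<le> mdist X x x')"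

text \<open>Finite metric spaces are taken with points in \<open>nat\<close>; every finite metric space is isometric to
  such a space.  \<open>F X \<sigma>\<close> is the filtration value of the nonempty subset \<open>\<sigma>\<close> of \<open>X\<close>, and a filtration
  functor sends a 1-Lipschitz map to the same underlying map of sets.\<close>

definition filtration_functor :: "(nat metric \<Rightarrow> nat set \<Rightarrow> real) \<Rightarrow> bool" where
  "filtration_functor F \<longleftrightarrow>
     (\<forall>X. finite_metric X \<longrightarrow>
        (\<forall>\<sigma> \<tau>. \<sigma> \<noteq> {} \<longrightarrow> \<sigma> \<subseteq> \<tau> \<longrightarrow> \<tau> \<subseteq> mspace X \<longrightarrow> F X \<sigma> \<le> F X \<tau>))
   \<and> (\<forall>X Y \<phi>. finite_metric X \<longrightarrow> finite_metric Y \<longrightarrow> lipschitz1 X Y \<phi> \<longrightarrow>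
        (\<forall>\<sigma>. \<sigma> \<noteq> {} \<longrightarrow> \<sigma> \<subseteq> mspace X \<longrightarrow> F Y (\<phi> ` \<sigma>) \<le> F X \<sigma>))"

definition sublevel_complex ::
  "(nat metric \<Rightarrow> nat set \<Rightarrow> real) \<Rightarrow> nat metric \<Rightarrow> real \<Rightarrow> nat set set"
where
  "sublevel_complex F X r = {\<sigma>. \<sigma> \<noteq> {} \<and> \<sigma> \<subseteq> mspace X \<and> F X \<sigma> \<le> r}"

text \<open>The field of coefficients is passed as a type.  The interval decomposition exists and is unique
  up to the order of the intervals.\<close>

definition dgm ::
  "'f::field itself \<Rightarrow> nat \<Rightarrow> (nat metric \<Rightarrow> nat set \<Rightarrow> real) \<Rightarrow> nat metric \<Rightarrow> pdiagram"
where
  "dgm (_ :: 'f itself) k F X = (THE D. \<exists>ps \<phi>. mset ps = Rep_pdiagram D \<and>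
     pmodule_iso (interval_sum ps :: ('f, _) pmodule) (homology_pmodule (sublevel_complex F X) k) \<phi>)"

section \<open>Stability\<close>

definition correspondences :: "'a set \<Rightarrow> 'b set \<Rightarrow> ('a \<times> 'b) set set" where
  "correspondences A B = {R. R \<subseteq> A \<times> B \<and> fst ` R = A \<and> snd ` R = B}"

definition distortion :: "'a metric \<Rightarrow> 'b metric \<Rightarrow> ('a \<times> 'b) set \<Rightarrow> real" where
  "distortion X Y R = (SUP ((x, y), (x', y')) \<in> R \<times> R. \<bar>mdist X x x' - mdist Y y y'\<bar>)"

definition gromov_hausdorff :: "'a metric \<Rightarrow> 'b metric \<Rightarrow> real" where
  "gromov_hausdorff X Y = (INF R\<in>correspondences (mspace X) (mspace Y). distortion X Y R) / 2"

definition stability_consts :: "'f::field itself \<Rightarrow> (nat metric \<Rightarrow> nat set \<Rightarrow> real) \<Rightarrow> real set" where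
  "stability_consts T F = {L. L > 0 \<and> (\<forall>X Y k. finite_metric X \<longrightarrow> finite_metric Y \<longrightarrow>
     dist (dgm T k F X) (dgm T k F Y) \<le> L * gromov_hausdorff X Y)}"

definition stable_functor :: "'f::field itself \<Rightarrow> (nat metric \<Rightarrow> nat set \<Rightarrow> real) \<Rightarrow> bool" where
  "stable_functor T F \<longleftrightarrow> stability_consts T F \<noteq> {}"

definition lipschitz_const :: "'f::field itself \<Rightarrow> (nat metric \<Rightarrow> nat set \<Rightarrow> real) \<Rightarrow> real" where
  "lipschitz_const T F = Inf (stability_consts T F)"

section \<open>Wasserstein distances\<close>

definition couplings :: "'a measure \<Rightarrow> 'b measure \<Rightarrow> ('a \<times> 'b) measure set" where
  "couplings \<mu> \<nu> = {\<gamma>. sets \<gamma> = sets (\<mu> \<Otimes>\<^sub>M \<nu>) \<and> distr \<gamma> \<mu> fst = \<mu> \<and> distr \<gamma> \<nu> snd = \<nu>}"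

text \<open>\<open>x powr (1 / p)\<close> on \<open>[0, \<infinity>]\<close>.\<close>

definition ennreal_root :: "real \<Rightarrow> ennreal \<Rightarrow> ennreal" where
  "ennreal_root p x = (if x = \<infinity> then \<infinity> else ennreal (enn2real x powr (1 / p)))"

definition wasserstein :: "real \<Rightarrow> ('a \<Rightarrow> 'a \<Rightarrow> real) \<Rightarrow> 'a measure \<Rightarrow> 'a measure \<Rightarrow> ennreal" where
  "wasserstein p d \<mu> \<nu> =
     (INF \<gamma>\<in>couplings \<mu> \<nu>. ennreal_root p (\<integral>\<^sup>+ (x, y). ennreal (d x y powr p) \<partial>\<gamma>))"

section \<open>Metric measure spaces, curvature measures and persistence measures\<close>

definition mm_space :: "'a metric \<Rightarrow> 'a measure \<Rightarrow> bool" where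
  "mm_space X \<mu> \<longleftrightarrow> compact_space (mtopology_of X) \<and> prob_space \<mu>
     \<and> space \<mu> = mspace X \<and> sets \<mu> = sigma_sets (mspace X) {U. openin (mtopology_of X) U}
     \<and> (\<forall>U. openin (mtopology_of X) U \<longrightarrow> U \<noteq> {} \<longrightarrow> emeasure \<mu> U > 0)"

text \<open>Real \<open>n \<times> n\<close> matrices are the elements of the product measurable space \<open>matrix_space n\<close>
  (functions of index pairs, \<open>undefined\<close> outside the index range).\<close>

definition matrix_space :: "nat \<Rightarrow> (nat \<times> nat \<Rightarrow> real) measure" where
  "matrix_space n = (\<Pi>\<^sub>M _\<in>{..<n} \<times> {..<n}. borel)"

definition linf_matrix :: "nat \<Rightarrow> (nat \<times> nat \<Rightarrow> real) \<Rightarrow> (nat \<times> nat \<Rightarrow> real) \<Rightarrow> real" where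
  "linf_matrix n M N = (MAX ij\<in>{..<n} \<times> {..<n}. \<bar>M ij - N ij\<bar>)"

definition distance_matrix :: "nat \<Rightarrow> 'a metric \<Rightarrow> (nat \<Rightarrow> 'a) \<Rightarrow> nat \<times> nat \<Rightarrow> real" where
  "distance_matrix n X x = (\<lambda>(i, j)\<in>{..<n} \<times> {..<n}. mdist X (x i) (x j))"

definition curvature_measure ::
  "nat \<Rightarrow> 'a metric \<Rightarrow> 'a measure \<Rightarrow> (nat \<times> nat \<Rightarrow> real) measure"
where
  "curvature_measure n X \<mu> = distr (\<Pi>\<^sub>M _\<in>{..<n}. \<mu>) (matrix_space n) (distance_matrix n X)"

definition is_distance_matrix :: "nat \<Rightarrow> (nat \<times> nat \<Rightarrow> real) \<Rightarrow> bool" where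
  "is_distance_matrix n M \<longleftrightarrow>
     (\<forall>i<n. M (i, i) = 0) \<and> (\<forall>i<n. \<forall>j<n. 0 \<le> M (i, j) \<and> M (i, j) = M (j, i))
   \<and> (\<forall>i<n. \<forall>j<n. \<forall>l<n. M (i, l) \<le> M (i, j) + M (j, l))"

text \<open>Identifying points at distance 0: each class is represented by its least index.\<close>

definition matrix_points :: "nat \<Rightarrow> (nat \<times> nat \<Rightarrow> real) \<Rightarrow> nat set" where
  "matrix_points n M = {i. i < n \<and> (\<forall>j<i. M (i, j) \<noteq> 0)}"

definition matrix_metric :: "nat \<Rightarrow> (nat \<times> nat \<Rightarrow> real) \<Rightarrow> nat metric" where
  "matrix_metric n M = metric (matrix_points n M,
     \<lambda>i j. if i < n \<and> j < n then M (i, j) else 0)"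

text \<open>Diagrams are only meaningful for distance matrices, which form a closed set of full measure
  for every curvature measure; other matrices get the empty diagram.\<close>

definition dgm_matrix ::
  "'f::field itself \<Rightarrow> nat \<Rightarrow> (nat metric \<Rightarrow> nat set \<Rightarrow> real) \<Rightarrow> nat \<Rightarrow> (nat \<times> nat \<Rightarrow> real) \<Rightarrow> pdiagram"
where
  "dgm_matrix T k F n M =
     (if is_distance_matrix n M then dgm T k F (matrix_metric n M) else Abs_pdiagram {#})"

definition persistence_measure ::
  "'f::field itself \<Rightarrow> (nat metric \<Rightarrow> nat set \<Rightarrow> real) \<Rightarrow> nat \<Rightarrow> nat \<Rightarrow> 'a metric \<Rightarrow> 'a measure
    \<Rightarrow> pdiagram measure"
where
  "persistence_measure T F n k X \<mu> = distr (curvature_measure n X \<mu>) borel (dgm_matrix T k F n)"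

definition modified_GW ::
  "real \<Rightarrow> 'a metric \<Rightarrow> 'a measure \<Rightarrow> 'b metric \<Rightarrow> 'b measure \<Rightarrow> ennreal"
where
  "modified_GW p X \<mu> Y \<nu> =
     (SUP n\<in>{1..}. wasserstein p (linf_matrix n) (curvature_measure n X \<mu>) (curvature_measure n Y \<nu>)) / 2"

lemma matrix_metric_simps:
  assumes "is_distance_matrix n M"
  shows "mspace (matrix_metric n M) = matrix_points n M"
    and "mdist (matrix_metric n M) i j = (if i < n \<and> j < n then M (i, j) else 0)"
proof -
  let ?d = "\<lambda>i j. if i < n \<and> j < n then M (i, j) else 0"
  have "Metric_space (matrix_points n M) ?d"
  proof
    show "0 \<le> ?d i j" "?d i j = ?d j i" for i j
      using assms unfolding is_distance_matrix_def by auto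
    show "?d i j = 0 \<longleftrightarrow> i = j" if "i \<in> matrix_points n M" "j \<in> matrix_points n M" for i j
      using that assms unfolding is_distance_matrix_def matrix_points_def
      by (cases i j rule: linorder_cases) auto
    show "?d i l \<le> ?d i j + ?d j l"
      if "i \<in> matrix_points n M" "j \<in> matrix_points n M" "l \<in> matrix_points n M" for i j l
      using that assms unfolding is_distance_matrix_def matrix_points_def by auto
  qed
  then show "mspace (matrix_metric n M) = matrix_points n M"
    "mdist (matrix_metric n M) i j = ?d i j"
    unfolding matrix_metric_def by (simp_all add: Metric_space.mspace_metric Metric_space.mdist_metric)
qed

end

theory Submission
  imports Defs
begin

text \<open>
  The map taking a distance matrix to its diagram is \<open>L / 2\<close>-Lipschitz for the \<open>\<ell>\<^sup>\<infinity>\<close> distance: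
  relating the classes of equal indices gives a correspondence whose distortion is at most the
  distance of the matrices.  Couplings of the curvature measures live on pairs of distance
  matrices, and pushing them forward along this map gives couplings of the persistence measures
  whose cost shrinks by the Lipschitz constant.
\<close>

section \<open>Lipschitz dependence of the diagram on the distance matrix\<close>

lemma distortion_nonneg:
  assumes "finite_metric X" "finite_metric Y" "R \<in> correspondences (mspace X) (mspace Y)"
  shows "0 \<le> distortion X Y R"
proof -
  let ?f = "\<lambda>((x, y), (x', y')). \<bar>mdist X x x' - mdist Y y y'\<bar>"
  \<comment> \<open>Finiteness bounds the family, so that its real supremum dominates each term; a
    point of \<open>X\<close> then yields a pair of \<open>R\<close> to compare with.\<close>
  have "finite R"
    using assms finite_subset[of R "mspace X \<times> mspace Y"]
    by (auto simp: correspondences_def finite_metric_def)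
  moreover obtain x y where "(x, y) \<in> R"
    using assms by (force simp: correspondences_def finite_metric_def)
  ultimately have "?f ((x, y), (x, y)) \<le> distortion X Y R"
    unfolding distortion_def by (intro cSUP_upper) auto
  then show ?thesis by (simp add: order_trans[OF abs_ge_zero])
qed

lemma gromov_hausdorff_nonneg:
  assumes "finite_metric X" "finite_metric Y"
  shows "0 \<le> gromov_hausdorff X Y"
proof -
  have "mspace X \<times> mspace Y \<in> correspondences (mspace X) (mspace Y)"
    using assms by (auto simp: correspondences_def finite_metric_def)
  then show ?thesis
    using assms unfolding gromov_hausdorff_def
    by (auto intro!: cINF_greatest distortion_nonneg)
qed

text \<open>The pointwise hypothesis bounds the distortion of \<open>R\<close>, and \<open>R\<close>
  competes in an infimum that \<open>distortion_nonneg\<close> bounds from below.\<close>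

lemma gromov_hausdorff_le:
  assumes "finite_metric X" "finite_metric Y" "R \<in> correspondences (mspace X) (mspace Y)"
    and "\<And>x y x' y'. (x, y) \<in> R \<Longrightarrow> (x', y') \<in> R \<Longrightarrow> \<bar>mdist X x x' - mdist Y y y'\<bar> \<le> c"
  shows "gromov_hausdorff X Y \<le> c / 2"
proof -
  have "R \<noteq> {}"
    using assms by (auto simp: correspondences_def finite_metric_def)
  then have "distortion X Y R \<le> c"
    unfolding distortion_def using assms(4) by (intro cSUP_least) auto
  moreover have "(INF R\<in>correspondences (mspace X) (mspace Y). distortion X Y R) \<le> distortion X Y R"
    using assms by (intro cINF_lower) (auto intro!: bdd_belowI[of _ 0] distortion_nonneg)
  ultimately show ?thesis unfolding gromov_hausdorff_def by simp
qed

lemma lipschitz_const_nonneg: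
  assumes "stable_functor TYPE('f::field) F"
  shows "0 \<le> lipschitz_const TYPE('f) F"
  using assms unfolding lipschitz_const_def stable_functor_def
  by (intro cInf_greatest) (auto simp: stability_consts_def)

text \<open>The infimum of the stability constants inherits their estimate, although it may be 0 and
  then is not one of them. If \<open>?g > 0\<close>, the quotient \<open>?d / ?g\<close> is a lower
  bound of all constants; if \<open>?g = 0\<close>, any single constant already forces
  \<open>?d \<le> 0\<close>.\<close>

lemma dist_dgm_le:
  assumes "stable_functor TYPE('f::field) F" "finite_metric X" "finite_metric Y"
  shows "dist (dgm TYPE('f) k F X) (dgm TYPE('f) k F Y)
           \<le> lipschitz_const TYPE('f) F * gromov_hausdorff X Y"
proof -
  let ?S = "stability_consts TYPE('f) F" and ?g = "gromov_hausdorff X Y"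
    and ?d = "dist (dgm TYPE('f) k F X) (dgm TYPE('f) k F Y)"
  have le: "?d \<le> L * ?g" if "L \<in> ?S" for L
    using that assms(2,3) unfolding stability_consts_def by blast
  show ?thesis
  proof (cases "?g = 0")
    case True
    then show ?thesis using assms(1) le by (auto simp: stable_functor_def)
  next
    case False
    then have g: "?g > 0" using gromov_hausdorff_nonneg[OF assms(2,3)] by simp
    have "?d / ?g \<le> Inf ?S"
      using assms(1) le g unfolding stable_functor_def
      by (intro cInf_greatest) (auto simp: field_simps)
    then show ?thesis using g unfolding lipschitz_const_def by (simp add: field_simps)
  qed
qed

section \<open>Sup distance of matrices and classes of indices at distance 0\<close>

lemma linf_matrix_upper:
  assumes "i < n" "j < n"
  shows "\<bar>M (i, j) - N (i, j)\<bar> \<le> linf_matrix n M N"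
  unfolding linf_matrix_def by (rule Max_ge) (use assms in force)+

lemma linf_matrix_nonneg:
  assumes "n \<ge> 1"
  shows "0 \<le> linf_matrix n M N"
  using linf_matrix_upper[of 0 n 0 M N] assms by linarith

text \<open>Trades the maximum for a finite sum, whose limit in
  \<open>continuous_on_dgm_matrix\<close> follows from the limits of the entries.\<close>

lemma linf_matrix_le_sum:
  assumes "n \<ge> 1"
  shows "linf_matrix n M N \<le> (\<Sum>ij\<in>{..<n} \<times> {..<n}. \<bar>M ij - N ij\<bar>)"
  using assms unfolding linf_matrix_def
  by (intro Max.boundedI) (auto simp: lessThan_empty_iff intro!: member_le_sum)

text \<open>The representative that \<open>matrix_points\<close> keeps. The \<open>LEAST\<close>
  carries no bound \<open>j < n\<close>: for \<open>i < n\<close> the zero diagonal of a distance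
  matrix makes \<open>i\<close> a candidate, so the value never exceeds \<open>i\<close>.\<close>

definition class_rep :: "(nat \<times> nat \<Rightarrow> real) \<Rightarrow> nat \<Rightarrow> nat" where
  "class_rep M i = (LEAST j. M (i, j) = 0)"

lemma class_rep:
  assumes M: "is_distance_matrix n M" and i: "i < n"
  shows "class_rep M i \<in> matrix_points n M" "M (i, class_rep M i) = 0" "class_rep M i \<le> i"
proof -
  have ii: "M (i, i) = 0" using M i by (simp add: is_distance_matrix_def)
  show z: "M (i, class_rep M i) = 0"
    unfolding class_rep_def by (rule LeastI, rule ii)
  show le: "class_rep M i \<le> i"
    unfolding class_rep_def by (rule Least_le, rule ii)
  \<comment> \<open>By the triangle inequality, an earlier index at distance 0 from the
    representative would be at distance 0 from \<open>i\<close>, against minimality.\<close>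
  have "M (class_rep M i, j) \<noteq> 0" if j: "j < class_rep M i" for j
  proof
    assume "M (class_rep M i, j) = 0"
    moreover have "M (i, j) \<le> M (i, class_rep M i) + M (class_rep M i, j)" "0 \<le> M (i, j)"
      using M i le j unfolding is_distance_matrix_def by (meson le_less_trans less_trans)+
    ultimately have "M (i, j) = 0" using z by simp
    then show False using j not_less_Least unfolding class_rep_def by blast
  qed
  then show "class_rep M i \<in> matrix_points n M"
    using le i by (auto simp: matrix_points_def)
qed

lemma class_rep_matrix_points:
  assumes M: "is_distance_matrix n M" and i: "i \<in> matrix_points n M"
  shows "class_rep M i = i"
proof -
  have "i < n" using i by (simp add: matrix_points_def)
  then show ?thesis
    using class_rep[OF M, of i] i by (auto simp: matrix_points_def le_less)
qed

text \<open>Moving an endpoint within its class costs distance 0, so triangle inequalities bound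
  each entry by the other.\<close>

lemma class_rep_entry:
  assumes M: "is_distance_matrix n M" and i: "i < n" and j: "j < n"
  shows "M (class_rep M i, class_rep M j) = M (i, j)"
proof -
  let ?i = "class_rep M i" and ?j = "class_rep M j"
  have lt: "?i < n" "?j < n" using class_rep(3)[OF M] i j by (meson le_less_trans)+
  have z: "M (i, ?i) = 0" "M (j, ?j) = 0" using class_rep(2)[OF M] i j by auto
  have tri: "M (a, c) \<le> M (a, b) + M (b, c)" if "a < n" "b < n" "c < n" for a b c
    using M that unfolding is_distance_matrix_def by blast
  have sym: "M (a, b) = M (b, a)" if "a < n" "b < n" for a b
    using M that unfolding is_distance_matrix_def by blast
  show ?thesis
    using tri[of ?i i ?j] tri[of i j ?j] tri[of i ?i j] tri[of ?i ?j j]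
      sym[of ?i i] sym[of ?j j] lt i j z by linarith
qed

lemma finite_metric_matrix_metric:
  assumes "is_distance_matrix n M" "n \<ge> 1"
  shows "finite_metric (matrix_metric n M)"
proof -
  have "0 \<in> matrix_points n M" using assms(2) by (simp add: matrix_points_def)
  moreover have "finite (matrix_points n M)" by (simp add: matrix_points_def)
  ultimately show ?thesis
    unfolding finite_metric_def matrix_metric_simps(1)[OF assms(1)] by auto
qed

lemma gromov_hausdorff_matrix_metric_le:
  assumes M: "is_distance_matrix n M" and N: "is_distance_matrix n N" and n: "n \<ge> 1"
  shows "gromov_hausdorff (matrix_metric n M) (matrix_metric n N) \<le> linf_matrix n M N / 2"
proof (rule gromov_hausdorff_le)
  \<comment> \<open>For two indices \<open>i\<close> and \<open>j\<close>,
    \<open>class_rep_entry\<close> turns the compared distances into \<open>M (i, j)\<close> and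
    \<open>N (i, j)\<close>.\<close>
  let ?R = "(\<lambda>i. (class_rep M i, class_rep N i)) ` {..<n}"
  have surj: "class_rep A ` {..<n} = matrix_points n A" if A: "is_distance_matrix n A" for A
  proof
    show "class_rep A ` {..<n} \<subseteq> matrix_points n A" using class_rep(1)[OF A] by auto
    show "matrix_points n A \<subseteq> class_rep A ` {..<n}"
    proof
      fix i assume i: "i \<in> matrix_points n A"
      then have "i = class_rep A i" "i < n"
        using class_rep_matrix_points[OF A] by (auto simp: matrix_points_def)
      then show "i \<in> class_rep A ` {..<n}" by blast
    qed
  qed
  show "?R \<in> correspondences (mspace (matrix_metric n M)) (mspace (matrix_metric n N))"
    unfolding correspondences_def matrix_metric_simps(1)[OF M] matrix_metric_simps(1)[OF N]
    using surj[OF M] surj[OF N] class_rep(1)[OF M] class_rep(1)[OF N] by (auto simp: image_image)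
  fix x y x' y'
  assume "(x, y) \<in> ?R" "(x', y') \<in> ?R"
  then obtain i j where ij: "i < n" "j < n" "x = class_rep M i" "y = class_rep N i"
    "x' = class_rep M j" "y' = class_rep N j" by auto
  have "x < n" "y < n" "x' < n" "y' < n"
    using class_rep(3)[OF M] class_rep(3)[OF N] ij by (auto intro: le_less_trans)
  then show "\<bar>mdist (matrix_metric n M) x x' - mdist (matrix_metric n N) y y'\<bar> \<le> linf_matrix n M N"
    using linf_matrix_upper[OF ij(1,2)]
    by (simp add: matrix_metric_simps(2)[OF M] matrix_metric_simps(2)[OF N] ij
        class_rep_entry[OF M] class_rep_entry[OF N])
qed (use assms finite_metric_matrix_metric in auto)

text \<open>The constant is halved because the Gromov-Hausdorff distance is half a
  distortion.\<close>

lemma dist_dgm_matrix_le: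
  assumes "stable_functor TYPE('f::field) F" "n \<ge> 1"
    and "is_distance_matrix n M" "is_distance_matrix n N"
  shows "dist (dgm_matrix TYPE('f) k F n M) (dgm_matrix TYPE('f) k F n N)
           \<le> lipschitz_const TYPE('f) F / 2 * linf_matrix n M N"
proof -
  have "dist (dgm_matrix TYPE('f) k F n M) (dgm_matrix TYPE('f) k F n N)
      \<le> lipschitz_const TYPE('f) F * gromov_hausdorff (matrix_metric n M) (matrix_metric n N)"
    using assms by (simp add: dgm_matrix_def dist_dgm_le finite_metric_matrix_metric)
  also have "\<dots> \<le> lipschitz_const TYPE('f) F * (linf_matrix n M N / 2)"
    using assms
    by (intro mult_left_mono gromov_hausdorff_matrix_metric_le lipschitz_const_nonneg)
  finally show ?thesis by simp
qed

section \<open>Measurability\<close>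

lemma measurable_coordinate_matrix_space [measurable]:
  "(\<lambda>M. M ij) \<in> borel_measurable (matrix_space n)"
proof (cases "ij \<in> {..<n} \<times> {..<n}")
  case True
  then show ?thesis unfolding matrix_space_def by (rule measurable_component_singleton)
next
  \<comment> \<open>Outside the index range every matrix takes the constant value
    \<open>undefined\<close>. Covering these pairs too lets \<open>measurable_dgm_matrix\<close>
    work in the full function space.\<close>
  case False
  have "M ij = undefined" if "M \<in> space (matrix_space n)" for M
    using that unfolding matrix_space_def space_PiM by (rule PiE_arb[OF _ False])
  then have "(\<lambda>M. M ij) \<in> borel_measurable (matrix_space n)
      \<longleftrightarrow> (\<lambda>M. undefined :: real) \<in> borel_measurable (matrix_space n)"
    by (rule measurable_cong)
  then show ?thesis by simp
qed

text \<open>The quantifiers range over the countable type \<open>nat\<close>, and bounds such as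
  \<open>i < n\<close> become implications with a constant premise; what remains are equalities and
  inequalities between coordinates.\<close>

lemma sets_is_distance_matrix [measurable]:
  "{M \<in> space (matrix_space n). is_distance_matrix n M} \<in> sets (matrix_space n)"
  unfolding is_distance_matrix_def
  by (intro sets.sets_Collect_conj sets.sets_Collect_countable_All sets.sets_Collect_imp
      sets.sets_Collect_const borel_measurable_le borel_measurable_eq borel_measurable_add
      borel_measurable_const measurable_coordinate_matrix_space)

text \<open>The topology is the product topology on all functions. The Lipschitz bound involves
  finitely many entries, each a continuous coordinate, and squeezes the distance of diagrams to
  0.\<close>

lemma continuous_on_dgm_matrix:
  assumes F: "stable_functor TYPE('f::field) F" and n: "n \<ge> 1"
  shows "continuous_on {M. is_distance_matrix n M} (dgm_matrix TYPE('f) k F n)"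
  unfolding continuous_on_def
proof
  let ?f = "dgm_matrix TYPE('f) k F n" and ?L = "lipschitz_const TYPE('f) F"
  fix N assume "N \<in> {M. is_distance_matrix n M}"
  then have N: "is_distance_matrix n N" by simp
  let ?F = "at N within {M. is_distance_matrix n M}"
  have "((\<lambda>M. M ij) \<longlongrightarrow> N ij) ?F" for ij
    using continuous_on_subset[OF continuous_on_product_coordinates[of ij] subset_UNIV] N
    unfolding continuous_on_def by blast
  then have "((\<lambda>M. ?L / 2 * (\<Sum>ij\<in>{..<n} \<times> {..<n}. \<bar>M ij - N ij\<bar>))
      \<longlongrightarrow> ?L / 2 * (\<Sum>ij\<in>{..<n} \<times> {..<n}. \<bar>N ij - N ij\<bar>)) ?F"
    by (intro tendsto_intros)
  then have lim: "((\<lambda>M. ?L / 2 * (\<Sum>ij\<in>{..<n} \<times> {..<n}. \<bar>M ij - N ij\<bar>)) \<longlongrightarrow> 0) ?F"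
    by simp
  have "dist (?f M) (?f N) \<le> ?L / 2 * (\<Sum>ij\<in>{..<n} \<times> {..<n}. \<bar>M ij - N ij\<bar>)"
    if "is_distance_matrix n M" for M
    using dist_dgm_matrix_le[OF F n that N, of k] lipschitz_const_nonneg[OF F]
      mult_left_mono[OF linf_matrix_le_sum[OF n, of M N], of "?L / 2"] by linarith
  then have "\<forall>\<^sub>F M in ?F. dist (?f M) (?f N)
      \<le> ?L / 2 * (\<Sum>ij\<in>{..<n} \<times> {..<n}. \<bar>M ij - N ij\<bar>)"
    by (simp add: eventually_at_filter)
  then have "((\<lambda>M. dist (?f M) (?f N)) \<longlongrightarrow> 0) ?F"
    by (intro tendsto_sandwich[OF _ _ tendsto_const lim]) auto
  then show "(?f \<longlongrightarrow> ?f N) ?F" by (subst tendsto_dist_iff)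
qed

lemma measurable_dgm_matrix:
  assumes F: "stable_functor TYPE('f::field) F" and n: "n \<ge> 1"
  shows "dgm_matrix TYPE('f) k F n \<in> matrix_space n \<rightarrow>\<^sub>M borel"
proof -
  let ?A = "{M. is_distance_matrix n M}"
  \<comment> \<open>Since there are countably many coordinates, coordinatewise measurability gives
    measurability for the Borel sets of the product topology, the ones that continuity refers
    to.\<close>
  have id: "(\<lambda>M. M) \<in> matrix_space n \<rightarrow>\<^sub>M borel"
    by (rule measurable_coordinatewise_then_product) measurable
  have "(\<lambda>M. M) \<in> restrict_space (matrix_space n) ?A \<rightarrow>\<^sub>M restrict_space borel ?A"
    by (rule measurable_restrict_space3[OF id]) auto
  from measurable_compose[OF this borel_measurable_continuous_on_restrict[OF continuous_on_dgm_matrix[OF F n]]]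
  have "dgm_matrix TYPE('f) k F n \<in> restrict_space (matrix_space n) ?A \<rightarrow>\<^sub>M borel" .
  \<comment> \<open>Off the distance matrices the value is the constant empty diagram, so the two
    branches glue to a measurable map.\<close>
  then have "(\<lambda>M. if is_distance_matrix n M then dgm_matrix TYPE('f) k F n M else Abs_pdiagram {#})
      \<in> matrix_space n \<rightarrow>\<^sub>M borel"
    by (subst measurable_If_restrict_space_iff) auto
  moreover have "(\<lambda>M. if is_distance_matrix n M then dgm_matrix TYPE('f) k F n M else Abs_pdiagram {#})
      = dgm_matrix TYPE('f) k F n"
    by (auto simp: dgm_matrix_def)
  ultimately show ?thesis by simp
qed

lemma measurable_linf_matrix:
  assumes n: "n \<ge> 1"
  shows "(\<lambda>(M, N). linf_matrix n M N) \<in> borel_measurable (matrix_space n \<Otimes>\<^sub>M matrix_space n)"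
proof -
  have "linf_matrix n M N = (SUP ij\<in>{..<n} \<times> {..<n}. \<bar>M ij - N ij\<bar>)" for M N
    using n unfolding linf_matrix_def by (intro cSup_eq_Max[symmetric]) (auto simp: lessThan_empty_iff)
  then have "(\<lambda>(M, N). linf_matrix n M N)
      = (\<lambda>z. SUP ij\<in>{..<n} \<times> {..<n}. \<bar>fst z ij - snd z ij\<bar>)"
    by (simp add: fun_eq_iff)
  then show ?thesis
    by (simp only:) (rule borel_measurable_cSUP; simp)
qed

section \<open>Distance functions and curvature measures of an mm-space\<close>

lemma mm_space_dense:
  assumes "mm_space X \<mu>"
  obtains D where "countable D" "D \<subseteq> mspace X" "D \<noteq> {}"
    "\<And>x e. x \<in> mspace X \<Longrightarrow> e > 0 \<Longrightarrow> \<exists>d\<in>D. mdist X x d < e"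
proof -
  interpret X: Metric_space "mspace X" "mdist X" by simp
  have "compact_space X.mtopology"
    using assms by (simp add: mm_space_def mtopology_of_def)
  then have "X.mtotally_bounded (mspace X)"
    by (simp add: X.compact_space_eq_mcomplete_mtotally_bounded)
  \<comment> \<open>Total boundedness gives a finite net at every scale \<open>1 / Suc m\<close>;
    the union of these nets is the countable dense set.\<close>
  then have "\<exists>K. finite K \<and> K \<subseteq> mspace X \<and> mspace X \<subseteq> (\<Union>x\<in>K. X.mball x (1 / Suc m))" for m
    unfolding X.mtotally_bounded_def by (meson divide_pos_pos of_nat_0_less_iff zero_less_Suc zero_less_one)
  then obtain K where K: "\<And>m. finite (K m)" "\<And>m. K m \<subseteq> mspace X"
    "\<And>m. mspace X \<subseteq> (\<Union>x\<in>K m. X.mball x (1 / Suc m))"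
    by metis
  have dense: "\<exists>d\<in>\<Union>(range K). mdist X x d < e" if x: "x \<in> mspace X" and e: "e > 0" for x e
  proof -
    obtain m where m: "1 / Suc m < e" using nat_approx_posE[OF e] by auto
    obtain d where d: "d \<in> K m" "x \<in> X.mball d (1 / Suc m)" using K(3)[of m] x by blast
    then have "mdist X x d < e" using m by (simp add: X.commute)
    then show ?thesis using d(1) by blast
  qed
  have "mspace X \<noteq> {}"
    using assms prob_space.not_empty unfolding mm_space_def by fastforce
  then have "\<Union>(range K) \<noteq> {}" using dense[of _ 1] by fastforce
  moreover have "countable (\<Union>(range K))" using K(1) by (simp add: countable_finite)
  ultimately show ?thesis using that[of "\<Union>(range K)"] dense K(2) by blast
qed

text \<open>Continuity alone speaks of the Borel sets of the product space. For the product
  \<open>\<sigma>\<close>-algebra, the distance is written as an infimum, over a countable dense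
  set, of sums of functions of one variable.\<close>

lemma measurable_mdist:
  assumes X: "mm_space X \<mu>"
  shows "(\<lambda>(x, y). mdist X x y) \<in> borel_measurable (\<mu> \<Otimes>\<^sub>M \<mu>)"
proof -
  interpret X: Metric_space "mspace X" "mdist X" by simp
  obtain D where D: "countable D" "D \<subseteq> mspace X" "D \<noteq> {}"
    "\<And>x e. x \<in> mspace X \<Longrightarrow> e > 0 \<Longrightarrow> \<exists>d\<in>D. mdist X x d < e"
    using mm_space_dense[OF X] by blast
  have sp: "space \<mu> = mspace X" using X by (simp add: mm_space_def)
  have [measurable]: "(\<lambda>x. mdist X d x) \<in> borel_measurable \<mu>" if d: "d \<in> D" for d
  proof (rule borel_measurableI_less)
    fix r
    have "{x \<in> space \<mu>. mdist X d x < r} = X.mball d r"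
      using d D(2) by (auto simp: sp)
    moreover have "openin (mtopology_of X) (X.mball d r)"
      by (simp add: mtopology_of_def)
    ultimately show "{x \<in> space \<mu>. mdist X d x < r} \<in> sets \<mu>"
      using X by (auto simp: mm_space_def intro!: sigma_sets.Basic)
  qed
  have eq: "mdist X x y = (INF d\<in>D. mdist X d x + mdist X d y)"
    if x: "x \<in> mspace X" and y: "y \<in> mspace X" for x y
  proof (rule antisym)
    show "mdist X x y \<le> (INF d\<in>D. mdist X d x + mdist X d y)"
      using D(2,3) x y X.triangle X.commute by (intro cINF_greatest) (auto, metis subsetD)
    show "(INF d\<in>D. mdist X d x + mdist X d y) \<le> mdist X x y"
    proof (rule field_le_epsilon)
      fix e :: real assume "e > 0"
      \<comment> \<open>The detour through \<open>d\<close> exceeds the direct distance by at most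
        twice \<open>mdist X x d\<close>, hence the choice of \<open>e / 2\<close>.\<close>
      then obtain d where d: "d \<in> D" "mdist X x d < e / 2" using D(4)[OF x, of "e / 2"] by auto
      have "(INF d\<in>D. mdist X d x + mdist X d y) \<le> mdist X d x + mdist X d y"
        using d(1) by (intro cINF_lower) (auto intro!: bdd_belowI[of _ 0])
      also have "\<dots> \<le> mdist X x y + e"
        using d D(2) X.triangle[of d x y] X.commute[of d x] x y by auto
      finally show "(INF d\<in>D. mdist X d x + mdist X d y) \<le> mdist X x y + e" .
    qed
  qed
  have "(\<lambda>z. INF d\<in>D. mdist X d (fst z) + mdist X d (snd z)) \<in> borel_measurable (\<mu> \<Otimes>\<^sub>M \<mu>)"
    using D(1) by (intro borel_measurable_cINF) (auto intro!: bdd_belowI[of _ 0] borel_measurable_add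
        measurable_compose[OF measurable_fst] measurable_compose[OF measurable_snd])
  then show ?thesis
    by (subst measurable_cong[of _ _ "\<lambda>z. INF d\<in>D. mdist X d (fst z) + mdist X d (snd z)"])
      (auto simp: space_pair_measure sp eq)
qed

lemma measurable_distance_matrix:
  assumes "mm_space X \<mu>"
  shows "distance_matrix n X \<in> (\<Pi>\<^sub>M _\<in>{..<n}. \<mu>) \<rightarrow>\<^sub>M matrix_space n"
proof -
  have "(\<lambda>x. mdist X (x i) (x j)) \<in> borel_measurable (\<Pi>\<^sub>M _\<in>{..<n}. \<mu>)" if "i < n" "j < n" for i j
  proof -
    have "(\<lambda>x. (x i, x j)) \<in> (\<Pi>\<^sub>M _\<in>{..<n}. \<mu>) \<rightarrow>\<^sub>M \<mu> \<Otimes>\<^sub>M \<mu>"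
      using that by (intro measurable_Pair measurable_component_singleton) auto
    from measurable_compose[OF this measurable_mdist[OF assms]] show ?thesis by simp
  qed
  then have "(\<lambda>x. \<lambda>ij\<in>{..<n} \<times> {..<n}. case ij of (i, j) \<Rightarrow> mdist X (x i) (x j))
      \<in> (\<Pi>\<^sub>M _\<in>{..<n}. \<mu>) \<rightarrow>\<^sub>M matrix_space n"
    unfolding matrix_space_def by (intro measurable_restrict) auto
  then show ?thesis unfolding distance_matrix_def[abs_def] .
qed

lemma sets_curvature_measure [simp, measurable_cong]:
  "sets (curvature_measure n X \<mu>) = sets (matrix_space n)"
  by (simp add: curvature_measure_def)

lemma prob_space_curvature_measure:
  assumes "mm_space X \<mu>"
  shows "prob_space (curvature_measure n X \<mu>)"
  unfolding curvature_measure_def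
  using assms by (intro prob_space.prob_space_distr prob_space_PiM measurable_distance_matrix)
    (auto simp: mm_space_def)

text \<open>Supplies the sets of full measure on which the Lipschitz bound applies: every tuple of
  points yields a distance matrix, and this passes through the pushforward.\<close>

lemma AE_curvature_measure:
  assumes "mm_space X \<mu>"
  shows "AE M in curvature_measure n X \<mu>. is_distance_matrix n M"
proof -
  have sp: "space \<mu> = mspace X" using assms by (simp add: mm_space_def)
  have "is_distance_matrix n (distance_matrix n X x)" if "x \<in> space (\<Pi>\<^sub>M _\<in>{..<n}. \<mu>)" for x
  proof -
    have "x i \<in> mspace X" if "i < n" for i
      using that \<open>x \<in> _\<close> by (auto simp: space_PiM sp)
    then show ?thesis
      by (auto simp: is_distance_matrix_def distance_matrix_def mdist_commute mdist_triangle)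
  qed
  then show ?thesis
    unfolding curvature_measure_def
    by (subst AE_distr_iff[OF measurable_distance_matrix[OF assms] sets_is_distance_matrix]) auto
qed

section \<open>Transport of couplings\<close>

lemma ennreal_root_mono:
  assumes "p > 0" "x \<le> y"
  shows "ennreal_root p x \<le> ennreal_root p y"
proof (cases "y = \<infinity>")
  case False
  then have "x \<noteq> \<infinity>" "y < \<infinity>" using assms(2) by (auto simp: top_unique less_top)
  then have "enn2real x powr (1 / p) \<le> enn2real y powr (1 / p)"
    using assms by (intro powr_mono2 enn2real_mono) auto
  then show ?thesis using False \<open>x \<noteq> \<infinity>\<close> by (simp add: ennreal_root_def ennreal_leI)
qed (simp add: ennreal_root_def)

text \<open>Homogeneity, used to take the Lipschitz constant out of the root. For
  \<open>c = 0\<close> and \<open>x = \<infinity>\<close> both sides vanish, as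
  \<open>0 * \<infinity> = 0\<close> in \<open>ennreal\<close>.\<close>

lemma ennreal_root_mult:
  assumes p: "p > 0" and c: "c \<ge> 0"
  shows "ennreal_root p (ennreal (c powr p) * x) = ennreal c * ennreal_root p x"
proof (cases "x = \<infinity>")
  case True
  then show ?thesis
    using assms by (cases "c = 0") (auto simp: ennreal_root_def ennreal_mult_top ennreal_eq_0_iff)
next
  case False
  then show ?thesis
    using assms by (auto simp: ennreal_root_def ennreal_mult_eq_top_iff enn2real_mult powr_mult powr_powr
        ennreal_mult[symmetric])
qed

text \<open>For \<open>c > 0\<close> one divides by \<open>c\<close>. Otherwise
  \<open>ennreal c\<close> is 0 and a single member of \<open>I\<close> forces \<open>a = 0\<close>,
  which is where nonemptiness enters.\<close>

lemma le_ennreal_mult_INF: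
  fixes f :: "'i \<Rightarrow> ennreal"
  assumes "I \<noteq> {}" "\<And>i. i \<in> I \<Longrightarrow> a \<le> ennreal c * f i"
  shows "a \<le> ennreal c * (INF i\<in>I. f i)"
proof (cases "c > 0")
  case True
  have "a / ennreal c \<le> (INF i\<in>I. f i)"
    using assms(2) True by (intro INF_greatest) (simp add: divide_le_posI_ennreal)
  then have "ennreal c * (a / ennreal c) \<le> ennreal c * (INF i\<in>I. f i)"
    by (rule mult_left_mono) simp
  then show ?thesis
    using True by (simp add: ennreal_times_divide mult.commute[of _ a] mult_divide_eq_ennreal)
next
  case False
  then show ?thesis using assms by (auto simp: ennreal_neg)
qed

text \<open>Only an inequality, because a distance need not be measurable for the product of the Borel
  \<open>\<sigma>\<close>-algebras when the space is not separable.\<close>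

lemma nn_integral_distr_le:
  assumes T: "T \<in> M \<rightarrow>\<^sub>M M'"
  shows "(\<integral>\<^sup>+ x. f x \<partial>distr M M' T) \<le> (\<integral>\<^sup>+ x. f (T x) \<partial>M)"
proof -
  \<comment> \<open>The integral is a supremum over simple functions below \<open>f\<close>; these
    are measurable, so the change of variables is exact for each of them.\<close>
  have "integral\<^sup>S (distr M M' T) g \<le> (\<integral>\<^sup>+ x. f (T x) \<partial>M)"
    if g: "simple_function (distr M M' T) g" "g \<le> f" for g
  proof -
    have "g \<in> borel_measurable (distr M M' T)"
      using g(1) by (rule borel_measurable_simple_function)
    then have "integral\<^sup>S (distr M M' T) g = (\<integral>\<^sup>+ x. g (T x) \<partial>M)"
      by (simp add: nn_integral_eq_simple_integral[OF g(1), symmetric] nn_integral_distr[OF T])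
    also have "\<dots> \<le> (\<integral>\<^sup>+ x. f (T x) \<partial>M)"
      using g(2) by (intro nn_integral_mono) (auto simp: le_fun_def)
    finally show ?thesis .
  qed
  then show ?thesis
    unfolding nn_integral_def[of "distr M M' T"] by (intro SUP_least) auto
qed

section \<open>Couplings and their pushforwards\<close>

lemma couplings_nonempty:
  assumes "prob_space \<mu>" "prob_space \<nu>"
  shows "\<mu> \<Otimes>\<^sub>M \<nu> \<in> couplings \<mu> \<nu>"
proof -
  interpret \<mu>: prob_space \<mu> by fact
  interpret \<nu>: prob_space \<nu> by fact
  interpret P: pair_prob_space \<mu> \<nu> ..
  have "distr (\<mu> \<Otimes>\<^sub>M \<nu>) \<nu> snd = \<nu>"
  proof (rule measure_eqI)
    fix A assume "A \<in> sets (distr (\<mu> \<Otimes>\<^sub>M \<nu>) \<nu> snd)"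
    then have A: "A \<in> sets \<nu>" by simp
    have "snd -` A \<inter> space (\<mu> \<Otimes>\<^sub>M \<nu>) = space \<mu> \<times> A"
      using sets.sets_into_space[OF A] by (auto simp: space_pair_measure)
    then show "emeasure (distr (\<mu> \<Otimes>\<^sub>M \<nu>) \<nu> snd) A = emeasure \<nu> A"
      using A by (simp add: emeasure_distr \<nu>.emeasure_pair_measure_Times \<mu>.emeasure_space_1)
  qed simp
  then show ?thesis
    by (simp add: couplings_def \<nu>.distr_pair_fst)
qed

lemma couplings_marginals:
  assumes "\<gamma> \<in> couplings \<mu> \<nu>"
  shows "distr \<gamma> \<mu> fst = \<mu>" "distr \<gamma> \<nu> snd = \<nu>"
  using assms by (simp_all add: couplings_def)

text \<open>Projecting after the product map is the same as mapping after projecting, so the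
  marginals of the pushforward are the pushforwards of the marginals.\<close>

lemma coupling_distr:
  assumes \<gamma>: "\<gamma> \<in> couplings \<mu> \<nu>" and f: "f \<in> \<mu> \<rightarrow>\<^sub>M S" and g: "g \<in> \<nu> \<rightarrow>\<^sub>M T"
  shows "distr \<gamma> (S \<Otimes>\<^sub>M T) (\<lambda>(x, y). (f x, g y)) \<in> couplings (distr \<mu> S f) (distr \<nu> T g)"
proof -
  have [measurable_cong]: "sets \<gamma> = sets (\<mu> \<Otimes>\<^sub>M \<nu>)" using \<gamma> by (simp add: couplings_def)
  note [measurable] = f g
  have fst: "fst \<in> \<gamma> \<rightarrow>\<^sub>M \<mu>" and snd: "snd \<in> \<gamma> \<rightarrow>\<^sub>M \<nu>" by measurable
  have h: "(\<lambda>(x, y). (f x, g y)) \<in> \<gamma> \<rightarrow>\<^sub>M S \<Otimes>\<^sub>M T" by measurable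
  have "distr (distr \<gamma> (S \<Otimes>\<^sub>M T) (\<lambda>(x, y). (f x, g y))) (distr \<mu> S f) fst = distr \<gamma> S (\<lambda>z. f (fst z))"
    by (subst distr_distr[OF _ h]) (auto simp: comp_def case_prod_beta intro!: distr_cong)
  also have "\<dots> = distr (distr \<gamma> \<mu> fst) S f"
    by (simp add: distr_distr[OF f fst] comp_def)
  finally have 1: "distr (distr \<gamma> (S \<Otimes>\<^sub>M T) (\<lambda>(x, y). (f x, g y))) (distr \<mu> S f) fst = distr \<mu> S f"
    using \<gamma> by (simp add: couplings_def)
  have "distr (distr \<gamma> (S \<Otimes>\<^sub>M T) (\<lambda>(x, y). (f x, g y))) (distr \<nu> T g) snd = distr \<gamma> T (\<lambda>z. g (snd z))"
    by (subst distr_distr[OF _ h]) (auto simp: comp_def case_prod_beta intro!: distr_cong)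
  also have "\<dots> = distr (distr \<gamma> \<nu> snd) T g"
    by (simp add: distr_distr[OF g snd] comp_def)
  finally have 2: "distr (distr \<gamma> (S \<Otimes>\<^sub>M T) (\<lambda>(x, y). (f x, g y))) (distr \<nu> T g) snd = distr \<nu> T g"
    using \<gamma> by (simp add: couplings_def)
  have "sets (S \<Otimes>\<^sub>M T) = sets (distr \<mu> S f \<Otimes>\<^sub>M distr \<nu> T g)"
    by (rule sets_pair_measure_cong) auto
  with 1 2 show ?thesis unfolding couplings_def by simp
qed

text \<open>A null set of a marginal pulls back along the projection to a null set of
  \<open>\<gamma>\<close>.\<close>

lemma AE_coupling:
  assumes \<gamma>: "\<gamma> \<in> couplings \<mu> \<nu>" and P: "AE x in \<mu>. P x" and Q: "AE y in \<nu>. Q y"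
  shows "AE z in \<gamma>. P (fst z) \<and> Q (snd z)"
proof -
  have [measurable_cong]: "sets \<gamma> = sets (\<mu> \<Otimes>\<^sub>M \<nu>)" using \<gamma> by (simp add: couplings_def)
  have fst: "fst \<in> \<gamma> \<rightarrow>\<^sub>M \<mu>" and snd: "snd \<in> \<gamma> \<rightarrow>\<^sub>M \<nu>" by measurable
  have "AE x in distr \<gamma> \<mu> fst. P x" "AE y in distr \<gamma> \<nu> snd. Q y"
    unfolding couplings_marginals[OF \<gamma>] by fact+
  then show ?thesis using AE_distrD[OF fst] AE_distrD[OF snd] by auto
qed

text \<open>\<open>P\<close> and \<open>Q\<close> confine the contraction estimate to sets of full
  measure. Measurability is assumed of the source cost \<open>d\<close>; for the target cost
  \<open>e\<close>, the inequality \<open>nn_integral_distr_le\<close> suffices.\<close>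

lemma wasserstein_distr_le:
  assumes p: "p > 0" and c: "c \<ge> 0"
    and \<mu>: "prob_space \<mu>" and \<nu>: "prob_space \<nu>"
    and f: "f \<in> \<mu> \<rightarrow>\<^sub>M S" and g: "g \<in> \<nu> \<rightarrow>\<^sub>M S"
    and d: "(\<lambda>(x, y). d x y) \<in> borel_measurable (\<mu> \<Otimes>\<^sub>M \<nu>)"
    and d_nonneg: "\<And>x y. 0 \<le> d x y" and e_nonneg: "\<And>x y. 0 \<le> e x y"
    and P: "AE x in \<mu>. P x" and Q: "AE y in \<nu>. Q y"
    and le: "\<And>x y. P x \<Longrightarrow> Q y \<Longrightarrow> e (f x) (g y) \<le> c * d x y"
  shows "wasserstein p e (distr \<mu> S f) (distr \<nu> S g) \<le> ennreal c * wasserstein p d \<mu> \<nu>"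
  unfolding wasserstein_def[of p d]
proof (rule le_ennreal_mult_INF)
  show "couplings \<mu> \<nu> \<noteq> {}" using couplings_nonempty[OF \<mu> \<nu>] by blast
  fix \<gamma> assume \<gamma>: "\<gamma> \<in> couplings \<mu> \<nu>"
  have [measurable_cong]: "sets \<gamma> = sets (\<mu> \<Otimes>\<^sub>M \<nu>)" using \<gamma> by (simp add: couplings_def)
  note [measurable] = f g d
  let ?h = "\<lambda>(x, y). (f x, g y)"
  have h: "?h \<in> \<gamma> \<rightarrow>\<^sub>M S \<Otimes>\<^sub>M S" by measurable
  have "wasserstein p e (distr \<mu> S f) (distr \<nu> S g)
      \<le> ennreal_root p (\<integral>\<^sup>+ (x, y). ennreal (e x y powr p) \<partial>distr \<gamma> (S \<Otimes>\<^sub>M S) ?h)"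
    unfolding wasserstein_def by (rule INF_lower) (rule coupling_distr[OF \<gamma> f g])
  also have "\<dots> \<le> ennreal_root p (ennreal (c powr p) * (\<integral>\<^sup>+ (x, y). ennreal (d x y powr p) \<partial>\<gamma>))"
  proof (rule ennreal_root_mono[OF p])
    have "(\<integral>\<^sup>+ (x, y). ennreal (e x y powr p) \<partial>distr \<gamma> (S \<Otimes>\<^sub>M S) ?h)
        \<le> (\<integral>\<^sup>+ z. ennreal (e (f (fst z)) (g (snd z)) powr p) \<partial>\<gamma>)"
      by (rule order_trans[OF nn_integral_distr_le[OF h]]) (simp add: case_prod_beta)
    also have "\<dots> \<le> (\<integral>\<^sup>+ z. ennreal (c powr p) * (case z of (x, y) \<Rightarrow> ennreal (d x y powr p)) \<partial>\<gamma>)"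
    proof (rule nn_integral_mono_AE)
      have "ennreal (e (f (fst z)) (g (snd z)) powr p)
          \<le> ennreal (c powr p) * (case z of (x, y) \<Rightarrow> ennreal (d x y powr p))"
        if "P (fst z) \<and> Q (snd z)" for z
        using that p c le[of "fst z" "snd z"] d_nonneg e_nonneg
        by (auto simp: case_prod_beta ennreal_mult[symmetric] powr_mult[symmetric]
            intro!: ennreal_leI powr_mono2)
      then show "AE z in \<gamma>. ennreal (e (f (fst z)) (g (snd z)) powr p)
          \<le> ennreal (c powr p) * (case z of (x, y) \<Rightarrow> ennreal (d x y powr p))"
        using AE_coupling[OF \<gamma> P Q] by auto
    qed
    also have "\<dots> = ennreal (c powr p) * (\<integral>\<^sup>+ (x, y). ennreal (d x y powr p) \<partial>\<gamma>)"
      by (rule nn_integral_cmult) measurable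
    finally show "(\<integral>\<^sup>+ (x, y). ennreal (e x y powr p) \<partial>distr \<gamma> (S \<Otimes>\<^sub>M S) ?h)
        \<le> ennreal (c powr p) * (\<integral>\<^sup>+ (x, y). ennreal (d x y powr p) \<partial>\<gamma>)" .
  qed
  also have "\<dots> = ennreal c * ennreal_root p (\<integral>\<^sup>+ (x, y). ennreal (d x y powr p) \<partial>\<gamma>)"
    by (rule ennreal_root_mult[OF p c])
  finally show "wasserstein p e (distr \<mu> S f) (distr \<nu> S g)
      \<le> ennreal c * ennreal_root p (\<integral>\<^sup>+ (x, y). ennreal (d x y powr p) \<partial>\<gamma>)" .
qed

theorem theorem3p19:
  fixes F :: "nat metric \<Rightarrow> nat set \<Rightarrow> real"
    and X :: "'a metric" and \<mu> :: "'a measure"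
    and Y :: "'b metric" and \<nu> :: "'b measure"
    and n k :: nat and p :: real
  assumes "filtration_functor F" and "stable_functor TYPE('f::field) F"
    and "mm_space X \<mu>" and "mm_space Y \<nu>"
    and "n \<ge> 1" and "p \<ge> 1"
  shows "wasserstein p dist (persistence_measure TYPE('f) F n k X \<mu>) (persistence_measure TYPE('f) F n k Y \<nu>)
           \<le> ennreal (lipschitz_const TYPE('f) F / 2)
               * wasserstein p (linf_matrix n) (curvature_measure n X \<mu>) (curvature_measure n Y \<nu>)
       \<and> wasserstein p dist (persistence_measure TYPE('f) F n k X \<mu>) (persistence_measure TYPE('f) F n k Y \<nu>)
           \<le> ennreal (lipschitz_const TYPE('f) F) * modified_GW p X \<mu> Y \<nu>"
proof
  let ?L = "lipschitz_const TYPE('f) F"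
  let ?W = "wasserstein p (linf_matrix n) (curvature_measure n X \<mu>) (curvature_measure n Y \<nu>)"
  let ?U = "wasserstein p dist (persistence_measure TYPE('f) F n k X \<mu>) (persistence_measure TYPE('f) F n k Y \<nu>)"
  \<comment> \<open>\<open>ennreal\<close> sends negative reals to 0, so the sign of the constant
    matters.\<close>
  have L: "?L \<ge> 0" using assms(2) by (rule lipschitz_const_nonneg)
  have pair: "sets (curvature_measure n X \<mu> \<Otimes>\<^sub>M curvature_measure n Y \<nu>)
      = sets (matrix_space n \<Otimes>\<^sub>M matrix_space n)"
    by (rule sets_pair_measure_cong) simp_all
  show main: "?U \<le> ennreal (?L / 2) * ?W"
    unfolding persistence_measure_def
  proof (rule wasserstein_distr_le)
    show "(\<lambda>(M, N). linf_matrix n M N)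
        \<in> borel_measurable (curvature_measure n X \<mu> \<Otimes>\<^sub>M curvature_measure n Y \<nu>)"
      using measurable_linf_matrix[OF assms(5)] by (simp add: measurable_cong_sets[OF pair refl])
    show "dgm_matrix TYPE('f) k F n \<in> curvature_measure n X \<mu> \<rightarrow>\<^sub>M borel"
      "dgm_matrix TYPE('f) k F n \<in> curvature_measure n Y \<nu> \<rightarrow>\<^sub>M borel"
      using measurable_dgm_matrix[OF assms(2,5), of k] by (simp_all cong: measurable_cong_sets)
    show "dist (dgm_matrix TYPE('f) k F n M) (dgm_matrix TYPE('f) k F n N) \<le> ?L / 2 * linf_matrix n M N"
      if "is_distance_matrix n M" "is_distance_matrix n N" for M N
      using that by (rule dist_dgm_matrix_le[OF assms(2,5)])
  qed (use assms L in \<open>auto intro: prob_space_curvature_measure AE_curvature_measure linf_matrix_nonneg\<close>)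
  \<comment> \<open>The given \<open>n\<close> is one of the sizes in the supremum; below, the 1/2
    of \<open>?L / 2\<close> is absorbed by the 1/2 in \<open>modified_GW\<close>.\<close>
  have "?W \<le> (SUP n\<in>{1..}. wasserstein p (linf_matrix n) (curvature_measure n X \<mu>) (curvature_measure n Y \<nu>))"
    using assms(5) by (intro SUP_upper) simp
  then have "?W / 2 \<le> modified_GW p X \<mu> Y \<nu>"
    unfolding modified_GW_def by (rule divide_right_mono_ennreal)
  then have "ennreal ?L * (?W / 2) \<le> ennreal ?L * modified_GW p X \<mu> Y \<nu>"
    by (rule mult_left_mono) simp
  moreover have "ennreal (?L / 2) * ?W = ennreal ?L * (?W / 2)"
    using L by (simp add: divide_ennreal[symmetric] ennreal_divide_times ennreal_times_divide)
  ultimately show "?U \<le> ennreal ?L * modified_GW p X \<mu> Y \<nu>" using main by simp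
qed

end
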